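(* Let $n\ge 6$ be an integer and $R_n^2=\langle (n-1)^2,n^2,(n+1)^2\rangle$. The matrix of minimal relations $\mathcal{A}$ of $R_n^2$ (with respect to $d_1=(n-1)^2$, $d_2=n^2$, $d_3=(n+1)^2$), its genus $G$ and its Frobenius number $F$ are as follows. (1) If $n=4m$, $m\ge 2$: $$\mathcal{A}=\begin{pmatrix}16m+1&-8(2m-1)&-1\\-(15m+1)&16m-7&-(m-1)\\-m&-1&m\end{pmatrix},$$ $G=4m(34m^2-21m+2)$, and $F=272m^3-168m^2+m-2$. (2) If $n=4m+2$, $m\ge 1$: $$\mathcal{A}=\begin{pmatrix}9m+5&-(8m-1)&-(m+1)\\-(7m+4)&8m+1&-m\\-(2m+1)&-2&2m+1\end{pmatrix},$$ $G=m(80m^2+71m+16)$, and $F=312$ if $m=1$, $F=160m^3+128m^2+10m-9$ if $m\ge 2$. (3) If $n=4m+1$, $m\ge 2$: $$\mathcal{A}=\begin{pmatrix}7m+2&-4(m-1)&-(3m+1)\\-(3m+1)&4m&-m\\-(4m+1)&-4&4m+1\end{pmatrix},$$ $G=2m(32m^2+9m+1)$, and $F=112m^3+48m^2+8m-1$ if $m\le 3$, $F=128m^3-20m-5$ if $m\ge 4$. (4) If $n=4m+3$, $m\ge 1$: $$\mathcal{A}=\begin{pmatrix}5m+4&-4m&-(m+1)\\-(m+1)&4(m+1)&-(3m+2)\\-(4m+3)&-4&4m+3\end{pmatrix},$$ $G=2(32m^3+57m^2+33m+6)$, and $F=128m^3+224m^2+124m+19$.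
   Context: For positive integers $d_1,d_2,d_3$ with $\gcd(d_1,d_2,d_3)=1$, $S=\langle d_1,d_2,d_3\rangle=\{x_1d_1+x_2d_2+x_3d_3 : x_i\in\mathbb{Z}_{\ge 0}\}$ is the numerical semigroup they generate. The Frobenius number $F(S)$ is the largest integer not in $S$; the genus $G(S)$ is the number of non-negative integers not in $S$. For a nonsymmetric $S=\langle d_1,d_2,d_3\rangle$, the matrix of minimal relations is the integer matrix $$\mathcal{A}=\begin{pmatrix}a_{11}&-a_{12}&-a_{13}\\-a_{21}&a_{22}&-a_{23}\\-a_{31}&-a_{32}&a_{33}\end{pmatrix},\qquad a_{ij}\in\mathbb{Z}_{\ge 0},$$ such that $\mathcal{A}(d_1,d_2,d_3)^{T}=0$, the greatest common divisor of the entries of each row is $1$, and for each $i$, with $\{i,j,k\}=\{1,2,3\}$, $a_{ii}=\min\{v\ge 2 : v\,d_i=v_jd_j+v_kd_k \text{ for some } v_j,v_k\in\mathbb{Z}_{\ge 0}\}$. (For nonsymmetric $S$ it is unique.) $S$ is symmetric if for every integer $s$ exactly one of $s,F(S)-s$ lies in $S$; the semigroups $R_n^2$ with $n\ge 6$ are nonsymmetric. *)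

theory Defs
  imports "HOL-Analysis.Analysis"
begin

definition semigroup_gen :: "int ^ 3 \<Rightarrow> int set" where
  "semigroup_gen d =
     {x1 * d $ 1 + x2 * d $ 2 + x3 * d $ 3 | x1 x2 x3. 0 \<le> x1 \<and> 0 \<le> x2 \<and> 0 \<le> x3}"

definition numerical_gens :: "int ^ 3 \<Rightarrow> bool" where
  "numerical_gens d \<longleftrightarrow> (\<forall>i. 0 < d $ i) \<and> Gcd (range (\<lambda>i. d $ i)) = 1"

definition frobenius_number :: "int set \<Rightarrow> int" where
  "frobenius_number S = (GREATEST s. s \<notin> S)"

definition genus :: "int set \<Rightarrow> nat" where
  "genus S = card {s. 0 \<le> s \<and> s \<notin> S}"

definition symmetric_semigroup :: "int set \<Rightarrow> bool" where
  "symmetric_semigroup S \<longleftrightarrow> (\<forall>s. (s \<in> S) \<noteq> (frobenius_number S - s \<in> S))"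

text \<open>The matrix \<open>A\<close> carries its signs: the entry \<open>A $ i $ j\<close> is \<open>a_ij\<close> for \<open>i = j\<close> and
  \<open>- a_ij\<close> otherwise, where the \<open>a_ij\<close> are nonnegative. The notion presupposes a nonsymmetric
  numerical semigroup, so this is part of the definition.\<close>

definition is_minimal_relations_matrix :: "int ^ 3 \<Rightarrow> int ^ 3 ^ 3 \<Rightarrow> bool" where
  "is_minimal_relations_matrix d A \<longleftrightarrow>
     numerical_gens d \<and> \<not> symmetric_semigroup (semigroup_gen d) \<and>
     (\<forall>i. 0 \<le> A $ i $ i) \<and> (\<forall>i j. i \<noteq> j \<longrightarrow> A $ i $ j \<le> 0) \<and>
     A *v d = 0 \<and>
     (\<forall>i. Gcd (range (\<lambda>j. A $ i $ j)) = 1) \<and>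
     (\<forall>i j k. {i, j, k} = {1, 2, 3} \<longrightarrow>
        A $ i $ i = (LEAST v. 2 \<le> v \<and>
          (\<exists>vj vk. 0 \<le> vj \<and> 0 \<le> vk \<and> v * d $ i = vj * d $ j + vk * d $ k)))"

definition R2_gens :: "int \<Rightarrow> int ^ 3" where
  "R2_gens n = vector [(n - 1)\<^sup>2, n\<^sup>2, (n + 1)\<^sup>2]"

definition R2 :: "int \<Rightarrow> int set" where
  "R2 n = semigroup_gen (R2_gens n)"

end

(* The matrices in question have vanishing column sums and the generators are their 2x2
   cofactors.  For every such matrix the L-shaped region under the staircase with corners
   (a22, 0), (a12, a13), (0, a33) has exactly d1 lattice points, and the three relations allow
   to move any (x, y) into it while subtracting positive multiples of d1 from x d2 + y d3.
   Hence the values x d2 + y d3 on the region form the Apery set of d1; its maximum yields the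
   Frobenius number, its sum the genus, and the minimality of the relations follows from the
   uniqueness of the representation together with the cyclic symmetry of the situation. *)
theory Submission
  imports Defs
begin

section \<open>Three-generator semigroups and sums of linear forms over boxes\<close>

definition gen3 :: "int \<Rightarrow> int \<Rightarrow> int \<Rightarrow> int set" where
  "gen3 d e f = {x * d + y * e + z * f | x y z. 0 \<le> x \<and> 0 \<le> y \<and> 0 \<le> z}"

lemma gen3I: "0 \<le> x \<Longrightarrow> 0 \<le> y \<Longrightarrow> 0 \<le> z \<Longrightarrow> x * d + y * e + z * f \<in> gen3 d e f"
  unfolding gen3_def by blast

lemma semigroup_gen_eq_gen3: "semigroup_gen d = gen3 (d $ 1) (d $ 2) (d $ 3)"
  by (simp add: semigroup_gen_def gen3_def)

lemma sum_int_lessThan: "0 \<le> b \<Longrightarrow> 2 * (\<Sum>x\<in>{0..<b::int}. x) = b * (b - 1)"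
proof (induction b rule: int_ge_induct)
  case (step i)
  have "{0..<i + 1} = insert i {0..<i}"
    using step.hyps by auto
  then show ?case using step.IH by (simp add: algebra_simps)
qed simp

lemma sum_int_interval:
  assumes "0 \<le> a" "a \<le> (b::int)"
  shows "2 * (\<Sum>x\<in>{a..<b}. x) = b * (b - 1) - a * (a - 1)"
proof -
  have "{0..<b} = {0..<a} \<union> {a..<b}" using assms by auto
  then have "(\<Sum>x\<in>{0..<b}. x) = (\<Sum>x\<in>{0..<a}. x) + (\<Sum>x\<in>{a..<b}. x)"
    by (simp add: sum.union_disjoint)
  then show ?thesis using sum_int_lessThan[of a] sum_int_lessThan[of b] assms by linarith
qed

text \<open>Each coordinate contributes an arithmetic series times the length of the other side. The
  factor 2 keeps the closed form free of division.\<close>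

lemma sum_linear_rectangle:
  assumes "0 \<le> a" "a \<le> b" "0 \<le> c" "c \<le> (e::int)"
  shows "2 * (\<Sum>(x, y)\<in>{a..<b} \<times> {c..<e}. x * u + y * v)
    = u * ((e - c) * (b * (b - 1) - a * (a - 1))) + v * ((b - a) * (e * (e - 1) - c * (c - 1)))"
proof -
  have "(\<Sum>(x, y)\<in>{a..<b} \<times> {c..<e}. x * u + y * v)
      = (\<Sum>x\<in>{a..<b}. \<Sum>y\<in>{c..<e}. x * u + y * v)"
    by (simp add: sum.cartesian_product)
  also have "\<dots> = u * ((e - c) * (\<Sum>x\<in>{a..<b}. x)) + v * ((b - a) * (\<Sum>y\<in>{c..<e}. y))"
    using assms by (simp add: sum.distrib sum_distrib_left sum_distrib_right mult_ac)
  finally show ?thesis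
    unfolding sum_int_interval[OF assms(1,2), symmetric] sum_int_interval[OF assms(3,4), symmetric]
    by (simp add: algebra_simps)
qed

text \<open>Only the off-diagonal entries, taken without their signs, are parameters. The vanishing
  column sums determine the diagonal as \<open>a21 + a31\<close>, \<open>a12 + a32\<close>,
  \<open>a13 + a23\<close>, and \<open>d1\<close>, \<open>d2\<close>, \<open>d3\<close> are the
  principal 2x2 minors of the resulting matrix.\<close>

locale cofactor_semigroup =
  fixes a12 a13 a21 a23 a31 a32 d1 d2 d3 :: int
  assumes pos: "0 < a12" "0 < a13" "0 < a21" "0 < a23" "0 < a31" "0 < a32"
    and d1: "d1 = (a12 + a32) * (a13 + a23) - a23 * a32"
    and d2: "d2 = (a21 + a31) * (a13 + a23) - a13 * a31"
    and d3: "d3 = (a21 + a31) * (a12 + a32) - a12 * a21"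
    and coprime: "gcd d1 (gcd d2 d3) = 1"
begin

text \<open>Shifting the indices 1, 2, 3 cyclically preserves all assumptions. Facts proved for row
  2 therefore carry over to row 3 by one rotation and to row 1 by two.\<close>

lemma rotate: "cofactor_semigroup a23 a21 a32 a31 a12 a13 d2 d3 d1"
  using pos d1 d2 d3 coprime
  by unfold_locales (auto simp: algebra_simps gcd.commute gcd.left_commute)

lemma d_pos: "0 < d1" "0 < d2" "0 < d3"
proof -
  have "d1 = a12 * a13 + a12 * a23 + a32 * a13" "d2 = a21 * a13 + a21 * a23 + a31 * a23"
    "d3 = a21 * a32 + a31 * a12 + a31 * a32"
    unfolding d1 d2 d3 by (auto simp: algebra_simps)
  then show "0 < d1" "0 < d2" "0 < d3"
    using pos by (auto intro!: add_pos_pos mult_pos_pos)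
qed

lemma relation1: "(a21 + a31) * d1 = a12 * d2 + a13 * d3"
  and relation2: "(a12 + a32) * d2 = a21 * d1 + a23 * d3"
  and relation3: "(a13 + a23) * d3 = a31 * d1 + a32 * d2"
  unfolding d1 d2 d3 by (auto simp: algebra_simps)

section \<open>The L-shaped region and the Apery set of \<open>d1\<close>\<close>

abbreviation S :: "int set" where "S \<equiv> gen3 d1 d2 d3"

definition L :: "(int \<times> int) set" where
  "L = {0..<a12 + a32} \<times> {0..<a13 + a23} - {a12..<a12 + a32} \<times> {a13..<a13 + a23}"

definition w :: "int \<times> int \<Rightarrow> int" where
  "w = (\<lambda>(x, y). x * d2 + y * d3)"

lemma finite_L: "finite L"
  by (simp add: L_def)

lemma card_L: "card L = nat d1"
proof -
  have "card L = card ({0..<a12 + a32} \<times> {0..<a13 + a23}) - card ({a12..<a12 + a32} \<times> {a13..<a13 + a23})"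
    unfolding L_def using pos by (intro card_Diff_subset) auto
  also have "\<dots> = nat ((a12 + a32) * (a13 + a23)) - nat (a32 * a23)"
    using pos by (simp add: card_cartesian_product nat_mult_distrib)
  also have "\<dots> = nat d1"
    using pos by (simp add: d1 nat_diff_distrib' mult.commute)
  finally show ?thesis .
qed

lemma w_nonneg: "p \<in> L \<Longrightarrow> 0 \<le> w p"
  using d_pos by (auto simp: L_def w_def)

text \<open>A point can leave \<open>L\<close> on the right, at the top, or into the removed corner.
  These cases call for row 2, row 3 and row 1 respectively, and the coefficient of \<open>d1\<close>
  in that row is the positive \<open>k\<close>.\<close>

lemma reduce_step:
  assumes "0 \<le> x" "0 \<le> y" "(x, y) \<notin> L"
  obtains k x' y' where "0 < k" "0 \<le> x'" "0 \<le> y'" "x * d2 + y * d3 = k * d1 + (x' * d2 + y' * d3)"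
proof -
  consider "a12 + a32 \<le> x" | "a13 + a23 \<le> y" | "a12 \<le> x" "a13 \<le> y"
    using assms unfolding L_def by fastforce
  then show ?thesis
  proof cases
    case 1
    show ?thesis
      by (rule that[of a21 "x - (a12 + a32)" "y + a23"])
        (use 1 assms pos relation2 in \<open>auto simp: algebra_simps\<close>)
  next
    case 2
    show ?thesis
      by (rule that[of a31 "x + a32" "y - (a13 + a23)"])
        (use 2 assms pos relation3 in \<open>auto simp: algebra_simps\<close>)
  next
    case 3
    show ?thesis
      by (rule that[of "a21 + a31" "x - a12" "y - a13"])
        (use 3 assms pos relation1 in \<open>auto simp: algebra_simps\<close>)
  qed
qed

text \<open>A single coordinate may grow in a reduction step, so the induction runs on the value
  \<open>x * d2 + y * d3\<close>, which drops by a positive multiple of \<open>d1\<close>.\<close>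

lemma reduce:
  assumes "0 \<le> x" "0 \<le> y"
  shows "\<exists>k\<ge>0. \<exists>p\<in>L. x * d2 + y * d3 = k * d1 + w p"
  using assms
proof (induction "nat (x * d2 + y * d3)" arbitrary: x y rule: less_induct)
  case less
  show ?case
  proof (cases "(x, y) \<in> L")
    case True
    then show ?thesis by (intro exI[of _ 0] conjI bexI[of _ "(x, y)"]) (auto simp: w_def)
  next
    case False
    then obtain k x' y' where k: "0 < k" "0 \<le> x'" "0 \<le> y'"
      "x * d2 + y * d3 = k * d1 + (x' * d2 + y' * d3)"
      using less.prems reduce_step by metis
    moreover have "0 < k * d1" "0 \<le> x' * d2 + y' * d3" using k d_pos by auto
    ultimately have "nat (x' * d2 + y' * d3) < nat (x * d2 + y * d3)" by linarith
    from less.hyps[OF this k(2,3)] obtain k' p where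
      "0 \<le> k'" "p \<in> L" "x' * d2 + y' * d3 = k' * d1 + w p" by blast
    with k show ?thesis by (intro exI[of _ "k + k'"]) (auto simp: algebra_simps)
  qed
qed

text \<open>Bezout writes every residue as an integer combination of the generators, and reduction
  moves it into \<open>L\<close>. As \<open>L\<close> has exactly \<open>d1\<close> points, this
  surjectivity also yields injectivity.\<close>

lemma residues_L: "(\<lambda>p. w p mod d1) ` L = {0..<d1}"
proof (intro subset_antisym subsetI)
  fix r assume r: "r \<in> {0..<d1}"
  obtain u t where ut: "u * d1 + t * gcd d2 d3 = 1" using coprime bezout_int by metis
  obtain v v' where vv': "v * d2 + v' * d3 = gcd d2 d3" using bezout_int by metis
  have "u * d1 + t * (v * d2 + v' * d3) = 1" unfolding vv' by (rule ut)
  then have "u * d1 + t * v * d2 + t * v' * d3 = 1" by (simp add: algebra_simps)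
  then have one: "r = r * u * d1 + r * t * v * d2 + r * t * v' * d3"
    by (metis (no_types, opaque_lifting) distrib_left mult.assoc mult.right_neutral)
  \<comment> \<open>Taking the Bezout coefficients modulo \<open>d1\<close> makes them nonnegative
    without changing the residue of the combination.\<close>
  define x y where "x = (r * t * v) mod d1" and "y = (r * t * v') mod d1"
  have "0 \<le> x" "0 \<le> y" using d_pos by (auto simp: x_def y_def)
  then obtain k p where k: "p \<in> L" "x * d2 + y * d3 = k * d1 + w p" using reduce by blast
  have "w p mod d1 = (x * d2 + y * d3) mod d1" using k by simp
  also have "\<dots> = (r * t * v * d2 + r * t * v' * d3) mod d1"
    unfolding x_def y_def by (intro mod_add_cong mod_mult_left_eq)
  also have "\<dots> = (r * u * d1 + r * t * v * d2 + r * t * v' * d3) mod d1"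
    by (simp add: add.assoc)
  also have "\<dots> = r" using r by (simp flip: one)
  finally show "r \<in> (\<lambda>p. w p mod d1) ` L" using k(1) by force
qed (use d_pos in auto)

lemma residues_inj: "inj_on (\<lambda>p. w p mod d1) L"
  by (rule eq_card_imp_inj_on) (simp_all add: finite_L card_L residues_L)

lemma apery_unique:
  assumes "p \<in> L" "q \<in> L" "k * d1 + w p = k' * d1 + w q"
  shows "p = q" "k = k'"
proof -
  have "w p mod d1 = w q mod d1" using arg_cong[OF assms(3), of "\<lambda>z. z mod d1"] by simp
  then show "p = q" using assms(1,2) residues_inj by (auto dest: inj_onD)
  then show "k = k'" using assms(3) d_pos by simp
qed

lemma apery_decomp:
  obtains k p where "p \<in> L" "z = k * d1 + w p"
proof -
  have "z mod d1 \<in> (\<lambda>p. w p mod d1) ` L" using residues_L d_pos by simp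
  then obtain p where p: "p \<in> L" "z mod d1 = w p mod d1" by auto
  then have "z = ((z - w p) div d1) * d1 + w p" by (simp add: mod_eq_dvd_iff)
  with p that show ?thesis by blast
qed

text \<open>This is the Apery property: \<open>w p\<close> is the least element of \<open>S\<close>
  in its class modulo \<open>d1\<close>. A representation of a member of \<open>S\<close> reduces to
  a point of \<open>L\<close> with a nonnegative multiple of \<open>d1\<close>, and by
  \<open>apery_unique\<close> that multiple is \<open>k\<close>.\<close>

lemma mem_S_iff:
  assumes "p \<in> L"
  shows "k * d1 + w p \<in> S \<longleftrightarrow> 0 \<le> k"
proof
  assume "k * d1 + w p \<in> S"
  then obtain x y z where "k * d1 + w p = x * d1 + y * d2 + z * d3" "0 \<le> x" "0 \<le> y" "0 \<le> z"
    unfolding gen3_def by blast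
  moreover from this obtain k' q where "0 \<le> k'" "q \<in> L" "y * d2 + z * d3 = k' * d1 + w q"
    using reduce by blast
  ultimately show "0 \<le> k" using apery_unique(2)[of p q k "x + k'"] assms
    by (simp add: algebra_simps)
next
  assume "0 \<le> k"
  with assms show "k * d1 + w p \<in> S"
    by (cases p) (auto simp: w_def L_def add.assoc[symmetric] intro!: gen3I)
qed

lemma sub_d1_notin_S: "p \<in> L \<Longrightarrow> w p - d1 \<notin> S"
  using mem_S_iff[of p "-1"] by simp

text \<open>Leaving \<open>L\<close> makes at least one copy of \<open>d1\<close> available, so one
  copy can be given up.\<close>

lemma sub_d1_in_S:
  assumes "0 \<le> x" "0 \<le> y" "(x, y) \<notin> L"
  shows "x * d2 + y * d3 - d1 \<in> S"
proof -
  obtain k x' y' where k: "0 < k" "0 \<le> x'" "0 \<le> y'"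
    "x * d2 + y * d3 = k * d1 + (x' * d2 + y' * d3)"
    using assms reduce_step by metis
  then have "x * d2 + y * d3 - d1 = (k - 1) * d1 + x' * d2 + y' * d3" by (simp add: algebra_simps)
  with gen3I[of "k - 1" x' y' d1 d2 d3] k(1-3) show ?thesis by simp
qed

section \<open>Frobenius number and failure of symmetry\<close>

lemma corners_in_L: "(a12 + a32 - 1, a13 - 1) \<in> L" "(a12 - 1, a13 + a23 - 1) \<in> L"
  using pos by (auto simp: L_def)

definition corner1 :: int where "corner1 = w (a12 + a32 - 1, a13 - 1)"
definition corner2 :: int where "corner2 = w (a12 - 1, a13 + a23 - 1)"

text \<open>\<open>L\<close> is the union of two boxes with lower left corner at the origin, and on
  each of them \<open>w\<close> is largest at the upper right corner.\<close>

lemma w_le_corner: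
  assumes "p \<in> L"
  shows "w p \<le> max corner1 corner2"
proof -
  obtain x y where p: "p = (x, y)" by force
  with assms consider "x \<le> a12 + a32 - 1" "y \<le> a13 - 1" | "x \<le> a12 - 1" "y \<le> a13 + a23 - 1"
    unfolding L_def by fastforce
  then show ?thesis
  proof cases
    case 1
    then have "w p \<le> corner1" unfolding p w_def corner1_def using d_pos
      by (auto intro!: add_mono mult_right_mono)
    then show ?thesis by simp
  next
    case 2
    then have "w p \<le> corner2" unfolding p w_def corner2_def using d_pos
      by (auto intro!: add_mono mult_right_mono)
    then show ?thesis by simp
  qed
qed

text \<open>The largest gap in a residue class lies one \<open>d1\<close> below its Apery element,
  so the largest gap overall belongs to the largest Apery element.\<close>

theorem frobenius_S: "frobenius_number S = max corner1 corner2 - d1"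
  unfolding frobenius_number_def
proof (rule Greatest_equality)
  show "max corner1 corner2 - d1 \<notin> S"
    using corners_in_L sub_d1_notin_S by (auto simp: max_def corner1_def corner2_def)
next
  fix z assume z: "z \<notin> S"
  obtain k p where p: "p \<in> L" "z = k * d1 + w p" by (rule apery_decomp)
  then have "k \<le> -1" using z mem_S_iff[of p k] by auto
  then have "k * d1 \<le> (-1) * d1" using d_pos by (intro mult_right_mono) auto
  then show "z \<le> max corner1 corner2 - d1" using p w_le_corner by fastforce
qed

text \<open>Both corners are maximal in the Apery set, so neither can be dominated by the other in the
  order induced by \<open>S\<close>; in a symmetric semigroup the larger one would dominate all others.\<close>

lemma corner_diff_notin_S:
  assumes "p \<in> L" "0 \<le> x" "0 \<le> y" "(x, y) \<in> L" "p \<noteq> (x, y)"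
    and up: "(x + 1, y) \<notin> L" "(x, y + 1) \<notin> L"
  shows "w p - w (x, y) \<notin> S"
proof
  assume "w p - w (x, y) \<in> S"
  then obtain i j k where e: "w p - w (x, y) = i * d1 + j * d2 + k * d3" "0 \<le> i" "0 \<le> j" "0 \<le> k"
    unfolding gen3_def by blast
  have "w p - d1 \<in> S"
  proof (cases "j = 0 \<and> k = 0")
    case True
    then have "w p = i * d1 + w (x, y)" using e by simp
    then show ?thesis using apery_unique(1)[of p "(x, y)" 0 i] assms by simp
  next
    case False
    \<comment> \<open>\<open>(u, v)\<close> is the right or upper neighbour of
      \<open>(x, y)\<close>, hence outside \<open>L\<close>, and still bounded by
      \<open>(x + j, y + k)\<close>. Subtracting \<open>d1\<close> at this neighbour keeps the total
      in \<open>S\<close>.\<close>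
    obtain u v where uv: "0 \<le> u" "0 \<le> v" "(u, v) \<notin> L" "u \<le> x + j" "v \<le> y + k"
    proof (cases "j = 0")
      case True
      with False e(4) have "1 \<le> k" by simp
      with True that[of x "y + 1"] up(2) assms(2,3) show ?thesis by simp
    next
      case False
      with e(3) have "1 \<le> j" by simp
      with that[of "x + 1" y] up(1) assms(2,3) e(4) show ?thesis by simp
    qed
    then obtain i' j' k' where "u * d2 + v * d3 - d1 = i' * d1 + j' * d2 + k' * d3"
      "0 \<le> i'" "0 \<le> j'" "0 \<le> k'"
      using sub_d1_in_S[OF uv(1-3)] unfolding gen3_def by blast
    moreover from this have "w p - d1 = (i + i') * d1 + (x + j - u + j') * d2 + (y + k - v + k') * d3"
      using e(1) by (simp add: w_def algebra_simps)
    ultimately show ?thesis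
      using gen3I[of "i + i'" "x + j - u + j'" "y + k - v + k'"]
        e(2) uv(4,5)
      by (metis add_nonneg_nonneg diff_ge_0_iff_ge)
  qed
  with sub_d1_notin_S[OF assms(1)] show False by contradiction
qed

lemma nonsymmetric: "\<not> symmetric_semigroup S"
proof
  assume sym: "symmetric_semigroup S"
  have "corner1 - corner2 \<notin> S" "corner2 - corner1 \<notin> S"
    using corner_diff_notin_S[OF corners_in_L(1) _ _ corners_in_L(2)]
      corner_diff_notin_S[OF corners_in_L(2) _ _ corners_in_L(1)] pos
    by (simp_all add: corner1_def corner2_def L_def)
  \<comment> \<open>Symmetry reflects the two gaps into \<open>S\<close>. For the smaller corner the
    reflection is the larger corner minus the smaller one, which was just excluded.\<close>
  moreover have "frobenius_number S - (corner1 - d1) \<in> S" "frobenius_number S - (corner2 - d1) \<in> S"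
    using sym sub_d1_notin_S[OF corners_in_L(1)] sub_d1_notin_S[OF corners_in_L(2)]
    unfolding symmetric_semigroup_def corner1_def corner2_def by metis+
  ultimately show False unfolding frobenius_S by (auto simp: max_def split: if_splits)
qed

section \<open>Genus\<close>

lemma sum_w: "2 * (\<Sum>p\<in>L. w p)
  = d2 * ((a13 + a23) * ((a12 + a32) * (a12 + a32 - 1))
      - a23 * ((a12 + a32) * (a12 + a32 - 1) - a12 * (a12 - 1)))
  + d3 * ((a12 + a32) * ((a13 + a23) * (a13 + a23 - 1))
      - a32 * ((a13 + a23) * (a13 + a23 - 1) - a13 * (a13 - 1)))"
proof -
  have "(\<Sum>p\<in>L. w p) = (\<Sum>p\<in>{0..<a12 + a32} \<times> {0..<a13 + a23}. w p)
      - (\<Sum>p\<in>{a12..<a12 + a32} \<times> {a13..<a13 + a23}. w p)"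
    unfolding L_def using pos by (intro sum_diff) auto
  then show ?thesis
    using pos sum_linear_rectangle[of 0 "a12 + a32" 0 "a13 + a23" d2 d3]
      sum_linear_rectangle[of a12 "a12 + a32" a13 "a13 + a23" d2 d3]
    by (simp add: w_def algebra_simps)
qed

text \<open>The nonnegative gaps in the class of \<open>w p\<close> are obtained by subtracting
  \<open>d1\<close> from \<open>w p\<close> between 1 and \<open>w p div d1\<close> times.\<close>

lemma genus_eq_sum: "int (genus S) = (\<Sum>p\<in>L. w p div d1)"
proof -
  have k_iff: "0 \<le> w p - k * d1 \<longleftrightarrow> k \<le> w p div d1" for p k
  proof -
    have "(w p - k * d1) div d1 = w p div d1 - k"
      using d_pos div_mult_self1[of d1 "w p" "- k"] by simp
    then show ?thesis using d_pos pos_imp_zdiv_nonneg_iff[of d1 "w p - k * d1"] by simp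
  qed
  have "bij_betw (\<lambda>(p, k). w p - k * d1) (SIGMA p:L. {1..w p div d1}) {s. 0 \<le> s \<and> s \<notin> S}"
  proof (rule bij_betwI')
    fix a b assume "a \<in> (SIGMA p:L. {1..w p div d1})" "b \<in> (SIGMA p:L. {1..w p div d1})"
    then show "((case a of (p, k) \<Rightarrow> w p - k * d1) = (case b of (p, k) \<Rightarrow> w p - k * d1)) = (a = b)"
      using apery_unique[of "fst a" "fst b" "- snd a" "- snd b"] by (auto simp: prod_eq_iff)
  next
    fix a assume "a \<in> (SIGMA p:L. {1..w p div d1})"
    then show "(case a of (p, k) \<Rightarrow> w p - k * d1) \<in> {s. 0 \<le> s \<and> s \<notin> S}"
      using mem_S_iff[of "fst a" "- snd a"] k_iff by auto
  next
    fix z assume z: "z \<in> {s. 0 \<le> s \<and> s \<notin> S}"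
    obtain k p where p: "p \<in> L" "z = k * d1 + w p" by (rule apery_decomp)
    then have "k < 0" using z mem_S_iff[of p k] by auto
    moreover have "- k \<le> w p div d1" using z p k_iff[of p "-k"] by (simp add: add.commute)
    ultimately show "\<exists>a\<in>(SIGMA p:L. {1..w p div d1}). z = (case a of (p, k) \<Rightarrow> w p - k * d1)"
      using p by (intro bexI[of _ "(p, - k)"]) auto
  qed
  then have "genus S = card (SIGMA p:L. {1..w p div d1})"
    unfolding genus_def by (rule bij_betw_same_card[symmetric])
  also have "\<dots> = (\<Sum>p\<in>L. nat (w p div d1))" using finite_L by (simp add: card_SigmaI)
  finally show ?thesis
    using w_nonneg d_pos by (simp add: pos_imp_zdiv_nonneg_iff)
qed

text \<open>This is Selmer's formula with denominators cleared. Division with remainder splits each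
  \<open>w p\<close>, and the remainders run through \<open>0\<close>, ..., \<open>d1 - 1\<close>
  once each.\<close>

theorem genus_S: "2 * d1 * int (genus S) = 2 * (\<Sum>p\<in>L. w p) - d1 * (d1 - 1)"
proof -
  have "(\<Sum>p\<in>L. w p) = (\<Sum>p\<in>L. d1 * (w p div d1) + w p mod d1)" by simp
  also have "\<dots> = d1 * int (genus S) + (\<Sum>p\<in>L. w p mod d1)"
    by (simp only: genus_eq_sum sum.distrib sum_distrib_left)
  also have "(\<Sum>p\<in>L. w p mod d1) = (\<Sum>x\<in>{0..<d1}. x)"
    using sum.reindex[OF residues_inj, of "\<lambda>x. x"] by (simp add: residues_L)
  finally show ?thesis using sum_int_lessThan[of d1] d_pos by (simp add: algebra_simps)
qed

section \<open>Minimality, uniqueness and primitivity of the relations\<close>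

lemma relation2_minimal:
  assumes "0 < v" "0 \<le> x" "0 \<le> z" "v * d2 = x * d1 + z * d3"
  shows "a12 + a32 \<le> v"
proof (rule ccontr)
  assume "\<not> ?thesis"
  then have v: "(v, 0) \<in> L" using assms(1) pos by (auto simp: L_def)
  \<comment> \<open>Otherwise \<open>z * d3 - d1\<close> would lie in \<open>S\<close>, and the
    assumed relation would put \<open>w (v, 0) - d1\<close> there as well.\<close>
  have z: "(0, z) \<in> L"
  proof (rule ccontr)
    assume "(0, z) \<notin> L"
    then have "0 * d2 + z * d3 - d1 \<in> S" using sub_d1_in_S assms by blast
    then obtain i j k where "0 * d2 + z * d3 - d1 = i * d1 + j * d2 + k * d3"
      "0 \<le> i" "0 \<le> j" "0 \<le> k" unfolding gen3_def by blast
    moreover from this have "w (v, 0) - d1 = (x + i) * d1 + j * d2 + k * d3"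
      using assms(4) by (simp add: w_def algebra_simps)
    ultimately have "w (v, 0) - d1 \<in> S" using assms(2) by (simp add: gen3I)
    then show False using v sub_d1_notin_S by blast
  qed
  \<comment> \<open>The relation now equates two representations over \<open>L\<close>, one of them
    with multiplier 0.\<close>
  have "(v, 0) = (0, z)"
    by (rule apery_unique(1)[of _ _ 0 x]) (use v z assms(4) in \<open>auto simp: w_def\<close>)
  then show False using assms(1) by simp
qed

lemmas rotate2 = cofactor_semigroup.rotate[OF rotate]

lemma relation3_minimal:
  assumes "0 < v" "0 \<le> x" "0 \<le> y" "v * d3 = x * d1 + y * d2"
  shows "a13 + a23 \<le> v"
  using cofactor_semigroup.relation2_minimal[OF rotate, of v y x] assms by (simp add: algebra_simps)

lemma relation1_minimal:
  assumes "0 < v" "0 \<le> y" "0 \<le> z" "v * d1 = y * d2 + z * d3"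
  shows "a21 + a31 \<le> v"
  using cofactor_semigroup.relation2_minimal[OF rotate2, of v z y] assms by (simp add: algebra_simps)

text \<open>The difference of two such relations equates a multiple of \<open>d1\<close> with a
  multiple of \<open>d3\<close>. If it is nonzero, one multiplier is positive and smaller than the
  diagonal entry of its row, against the minimality of row 3 or row 1.\<close>

lemma relation2_unique:
  assumes "0 \<le> x" "0 \<le> z" "(a12 + a32) * d2 = x * d1 + z * d3"
  shows "x = a21" "z = a23"
proof -
  have e: "(x - a21) * d1 = (a23 - z) * d3"
    using assms(3) relation2 by (simp add: algebra_simps)
  have "\<not> a21 < x"
  proof
    assume "a21 < x"
    then have "0 < (a23 - z) * d3" using e d_pos by (metis diff_gt_0_iff_gt mult_pos_pos)
    then have "0 < a23 - z" using d_pos by (simp add: zero_less_mult_iff)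
    then have "a13 + a23 \<le> a23 - z"
      using relation3_minimal[of "a23 - z" "x - a21" 0] e \<open>a21 < x\<close> by simp
    then show False using pos assms by simp
  qed
  moreover have "\<not> x < a21"
  proof
    assume "x < a21"
    then have "0 < (a21 - x) * d1" using d_pos by simp
    also have e': "(a21 - x) * d1 = (z - a23) * d3" using e by (simp add: algebra_simps)
    finally have "0 < z - a23" using d_pos by (simp add: zero_less_mult_iff)
    then have "a21 + a31 \<le> a21 - x"
      using relation1_minimal[of "a21 - x" 0 "z - a23"] e' \<open>x < a21\<close> by simp
    then show False using pos assms by simp
  qed
  ultimately show "x = a21" by simp
  then show "z = a23" using e d_pos by simp
qed

lemma relation2_least:
  "(LEAST v. 2 \<le> v \<and> (\<exists>x z. 0 \<le> x \<and> 0 \<le> z \<and> v * d2 = x * d1 + z * d3)) = a12 + a32"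
proof (rule Least_equality)
  have "\<exists>x z. 0 \<le> x \<and> 0 \<le> z \<and> (a12 + a32) * d2 = x * d1 + z * d3"
    by (rule exI[of _ a21], rule exI[of _ a23]) (use pos relation2 in simp)
  then show "2 \<le> a12 + a32 \<and> (\<exists>x z. 0 \<le> x \<and> 0 \<le> z \<and> (a12 + a32) * d2 = x * d1 + z * d3)"
    using pos by simp
next
  fix v assume "2 \<le> v \<and> (\<exists>x z. 0 \<le> x \<and> 0 \<le> z \<and> v * d2 = x * d1 + z * d3)"
  then show "a12 + a32 \<le> v" using relation2_minimal[of v] by fastforce
qed

text \<open>Dividing the row by a common factor \<open>g\<close> leaves a valid relation, so
  minimality gives \<open>g * v \<le> v\<close> and hence \<open>g = 1\<close>.\<close>

lemma relation2_primitive: "gcd (a12 + a32) (gcd a21 a23) = 1"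
proof -
  define g where "g = gcd (a12 + a32) (gcd a21 a23)"
  have "g dvd a12 + a32" "g dvd a21" "g dvd a23"
    unfolding g_def by (auto intro: dvd_trans)
  then obtain v x z where e: "a12 + a32 = g * v" "a21 = g * x" "a23 = g * z"
    by (auto simp: dvd_def)
  have g: "0 < g" using pos unfolding g_def by simp
  have p: "0 < v" "0 < x" "0 < z"
    using zero_less_mult_pos[of g v] zero_less_mult_pos[of g x] zero_less_mult_pos[of g z] pos g
    by (simp_all flip: e)
  have "g * (v * d2) = g * (x * d1 + z * d3)"
    using relation2 unfolding e by (simp add: algebra_simps)
  then have "g * v \<le> v" using relation2_minimal[of v x z] p g e(1) by simp
  then show ?thesis using p g unfolding g_def[symmetric] by simp
qed

lemmas relation3_unique = cofactor_semigroup.relation2_unique[OF rotate]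
lemmas relation1_unique = cofactor_semigroup.relation2_unique[OF rotate2]
lemmas relation3_least = cofactor_semigroup.relation2_least[OF rotate]
lemmas relation1_least = cofactor_semigroup.relation2_least[OF rotate2]
lemmas relation3_primitive = cofactor_semigroup.relation2_primitive[OF rotate]
lemmas relation1_primitive = cofactor_semigroup.relation2_primitive[OF rotate2]

end

section \<open>The matrix of minimal relations over the index type 3\<close>

lemma forall_triple_3:
  "(\<forall>i j k::3. {i, j, k} = {1, 2, 3} \<longrightarrow> Q i j k) \<longleftrightarrow>
    Q 1 2 3 \<and> Q 1 3 2 \<and> Q 2 1 3 \<and> Q 2 3 1 \<and> Q 3 1 2 \<and> Q 3 2 1"
proof -
  have "{i, j, k} = {1, 2, 3} \<longleftrightarrow> (i, j, k) \<in> {(1, 2, 3), (1, 3, 2), (2, 1, 3), (2, 3, 1), (3, 1, 2), (3, 2, 1)}"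
    for i j k :: 3
    using exhaust_3[of i] exhaust_3[of j] exhaust_3[of k]
    by (elim disjE) (simp_all add: set_eq_iff forall_3)
  then show ?thesis by auto
qed

lemma Gcd_range_3: "Gcd (range (f :: 3 \<Rightarrow> int)) = gcd (f 1) (gcd (f 2) (f 3))"
  by (simp add: UNIV_3)

text \<open>The defining condition of the matrix covers both orders of \<open>j\<close> and
  \<open>k\<close>, while the rotations supply only one order per row.\<close>

lemma Least_relation_swap:
  fixes d e f :: int
  shows "(LEAST v. 2 \<le> v \<and> (\<exists>x y. 0 \<le> x \<and> 0 \<le> y \<and> v * d = x * e + y * f))
    = (LEAST v. 2 \<le> v \<and> (\<exists>x y. 0 \<le> x \<and> 0 \<le> y \<and> v * d = x * f + y * e))"
proof -
  have "\<exists>x y. 0 \<le> x \<and> 0 \<le> y \<and> v * d = x * f + y * e"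
    if "\<exists>x y. 0 \<le> x \<and> 0 \<le> y \<and> v * d = x * e + y * f" for v e f :: int
    using that by (metis add.commute)
  then show ?thesis by (intro arg_cong[where f = Least] ext conj_cong refl iffI)
qed

context cofactor_semigroup
begin

lemmas relations_least = relation1_least relation2_least relation3_least
  trans[OF Least_relation_swap relation1_least] trans[OF Least_relation_swap relation2_least]
  trans[OF Least_relation_swap relation3_least]

text \<open>For a matrix satisfying the definition, the least multipliers fix the diagonal, and
  uniqueness of the representations then fixes the remaining entries of each row.\<close>

theorem minimal_relations_matrix_iff:
  assumes d: "d $ 1 = d1" "d $ 2 = d2" "d $ 3 = d3"
  shows "is_minimal_relations_matrix d A \<longleftrightarrow>
    A = vector [vector [a21 + a31, - a12, - a13],
                vector [- a21, a12 + a32, - a23],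
                vector [- a31, - a32, a13 + a23]]"
    (is "_ \<longleftrightarrow> A = ?M")
proof
  assume "A = ?M"
  moreover have "numerical_gens d"
    using d_pos coprime by (simp add: numerical_gens_def forall_3 Gcd_range_3 d)
  moreover have "?M *v d = 0"
    using relation1 relation2 relation3
    by (simp add: matrix_vector_mult_def vec_eq_iff forall_3 sum_3 d)
  moreover have "gcd a21 (gcd (a12 + a32) a23) = 1" "gcd a31 (gcd a32 (a13 + a23)) = 1"
    "gcd (a21 + a31) (gcd a12 a13) = 1"
    using relation1_primitive relation2_primitive relation3_primitive
    by (simp_all add: ac_simps)
  ultimately show "is_minimal_relations_matrix d A"
    using pos nonsymmetric relations_least
    unfolding is_minimal_relations_matrix_def forall_triple_3
    by (simp add: semigroup_gen_eq_gen3 forall_3 Gcd_range_3 d Least_relation_swap add.commute)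
next
  assume A: "is_minimal_relations_matrix d A"
  then have diag: "A $ 1 $ 1 = a21 + a31" "A $ 2 $ 2 = a12 + a32" "A $ 3 $ 3 = a13 + a23"
    using relations_least
    unfolding is_minimal_relations_matrix_def forall_triple_3 d by (simp_all add: ac_simps)
  from A have "A $ i $ j \<le> 0" if "i \<noteq> j" for i j
    using that unfolding is_minimal_relations_matrix_def by blast
  then have sgn: "0 \<le> - A $ 1 $ 2" "0 \<le> - A $ 1 $ 3" "0 \<le> - A $ 2 $ 1" "0 \<le> - A $ 2 $ 3"
    "0 \<le> - A $ 3 $ 1" "0 \<le> - A $ 3 $ 2"
    by simp_all
  from A have "A *v d = 0"
    unfolding is_minimal_relations_matrix_def by blast
  \<comment> \<open>The summands are ordered as in the rotated versions of row 2, so that the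
    uniqueness facts apply literally.\<close>
  then have rel: "(a31 + a21) * d1 = (- A $ 1 $ 3) * d3 + (- A $ 1 $ 2) * d2"
    "(a12 + a32) * d2 = (- A $ 2 $ 1) * d1 + (- A $ 2 $ 3) * d3"
    "(a23 + a13) * d3 = (- A $ 3 $ 2) * d2 + (- A $ 3 $ 1) * d1"
    by (simp_all add: matrix_vector_mult_def vec_eq_iff forall_3 sum_3 d diag add.commute)
  note relation1_unique[OF sgn(2,1) rel(1)]
  moreover note relation2_unique[OF sgn(3,4) rel(2)]
  moreover note relation3_unique[OF sgn(6,5) rel(3)]
  ultimately show "A = ?M"
    using diag by (simp add: vec_eq_iff forall_3)
qed

end

section \<open>Semigroups generated by three consecutive squares\<close>

lemma R2_eq_gen3: "R2 n = gen3 ((n - 1)\<^sup>2) (n\<^sup>2) ((n + 1)\<^sup>2)"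
  by (simp add: R2_def semigroup_gen_eq_gen3 R2_gens_def)

lemma R2_cofactor_semigroup:
  fixes n :: int
  assumes "0 < a12" "0 < a13" "0 < a21" "0 < a23" "0 < a31" "0 < a32"
    and "(n - 1)\<^sup>2 = (a12 + a32) * (a13 + a23) - a23 * a32"
    and "n\<^sup>2 = (a21 + a31) * (a13 + a23) - a13 * a31"
    and "(n + 1)\<^sup>2 = (a21 + a31) * (a12 + a32) - a12 * a21"
  shows "cofactor_semigroup a12 a13 a21 a23 a31 a32 ((n - 1)\<^sup>2) (n\<^sup>2) ((n + 1)\<^sup>2)"
proof
  have "coprime (n - 1) n" by (rule coprime_diff_one_left)
  then have "coprime ((n - 1)\<^sup>2) (n\<^sup>2)" by simp
  then show "gcd ((n - 1)\<^sup>2) (gcd (n\<^sup>2) ((n + 1)\<^sup>2)) = 1"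
    by (simp add: gcd.assoc[symmetric])
qed (use assms in auto)

text \<open>This reduces each family to arithmetic. The condition on \<open>G\<close> is the genus
  formula before cancelling \<open>2 * (n - 1)\<^sup>2\<close>, and the two Frobenius formulas
  correspond to which corner is larger.\<close>

lemma R2_invariants:
  fixes n :: int
  assumes "0 < a12" "0 < a13" "0 < a21" "0 < a23" "0 < a31" "0 < a32"
    and n: "(n - 1)\<^sup>2 = (a12 + a32) * (a13 + a23) - a23 * a32"
      "n\<^sup>2 = (a21 + a31) * (a13 + a23) - a13 * a31"
      "(n + 1)\<^sup>2 = (a21 + a31) * (a12 + a32) - a12 * a21"
    and G: "2 * (n - 1)\<^sup>2 * G =
      n\<^sup>2 * ((a13 + a23) * ((a12 + a32) * (a12 + a32 - 1))
        - a23 * ((a12 + a32) * (a12 + a32 - 1) - a12 * (a12 - 1)))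
      + (n + 1)\<^sup>2 * ((a12 + a32) * ((a13 + a23) * (a13 + a23 - 1))
        - a32 * ((a13 + a23) * (a13 + a23 - 1) - a13 * (a13 - 1)))
      - (n - 1)\<^sup>2 * ((n - 1)\<^sup>2 - 1)"
  shows "is_minimal_relations_matrix (R2_gens n) A \<longleftrightarrow>
      A = vector [vector [a21 + a31, - a12, - a13],
                  vector [- a21, a12 + a32, - a23],
                  vector [- a31, - a32, a13 + a23]]"
    and "int (genus (R2 n)) = G"
    and "a32 * n\<^sup>2 \<le> a23 * (n + 1)\<^sup>2 \<Longrightarrow> frobenius_number (R2 n) =
      (a12 - 1) * n\<^sup>2 + (a13 + a23 - 1) * (n + 1)\<^sup>2 - (n - 1)\<^sup>2"
    and "a23 * (n + 1)\<^sup>2 \<le> a32 * n\<^sup>2 \<Longrightarrow> frobenius_number (R2 n) =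
      (a12 + a32 - 1) * n\<^sup>2 + (a13 - 1) * (n + 1)\<^sup>2 - (n - 1)\<^sup>2"
proof -
  interpret cofactor_semigroup a12 a13 a21 a23 a31 a32 "(n - 1)\<^sup>2" "n\<^sup>2" "(n + 1)\<^sup>2"
    using assms(1-6) n by (rule R2_cofactor_semigroup)
  show "is_minimal_relations_matrix (R2_gens n) A \<longleftrightarrow>
      A = vector [vector [a21 + a31, - a12, - a13],
                  vector [- a21, a12 + a32, - a23],
                  vector [- a31, - a32, a13 + a23]]"
    by (rule minimal_relations_matrix_iff) (simp_all add: R2_gens_def)
  have "2 * (n - 1)\<^sup>2 * int (genus (R2 n)) = 2 * (n - 1)\<^sup>2 * G"
    unfolding R2_eq_gen3 genus_S sum_w G ..
  then show "int (genus (R2 n)) = G" using d_pos(1) by simp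
  have "frobenius_number (R2 n) = max corner1 corner2 - (n - 1)\<^sup>2"
    by (simp only: R2_eq_gen3 frobenius_S)
  moreover have "corner1 = (a12 + a32 - 1) * n\<^sup>2 + (a13 - 1) * (n + 1)\<^sup>2"
    "corner2 = (a12 - 1) * n\<^sup>2 + (a13 + a23 - 1) * (n + 1)\<^sup>2"
    by (simp_all add: corner1_def corner2_def w_def)
  moreover from this have "corner2 - corner1 = a23 * (n + 1)\<^sup>2 - a32 * n\<^sup>2"
    by (simp add: algebra_simps)
  ultimately show "a32 * n\<^sup>2 \<le> a23 * (n + 1)\<^sup>2 \<Longrightarrow> frobenius_number (R2 n) =
      (a12 - 1) * n\<^sup>2 + (a13 + a23 - 1) * (n + 1)\<^sup>2 - (n - 1)\<^sup>2"
    and "a23 * (n + 1)\<^sup>2 \<le> a32 * n\<^sup>2 \<Longrightarrow> frobenius_number (R2 n) =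
      (a12 + a32 - 1) * n\<^sup>2 + (a13 - 1) * (n + 1)\<^sup>2 - (n - 1)\<^sup>2"
    by auto
qed

text \<open>With \<open>a = a32\<close> and \<open>b = a23\<close> this gives a simple criterion for
  \<open>corner2\<close> to be the larger corner.\<close>

lemma mult_square_mono:
  fixes n :: int
  assumes "0 \<le> n" "0 \<le> a" "a \<le> b"
  shows "a * n\<^sup>2 \<le> b * (n + 1)\<^sup>2"
  using assms by (intro mult_mono power_mono) auto

text \<open>In each residue class of \<open>n\<close> modulo 4 the off-diagonal entries of the
  claimed matrix, without signs, are inserted into \<open>R2_invariants\<close>. Polynomial
  identities in \<open>m\<close> and the comparison of the two corners remain.\<close>

theorem mainTheorem4:
  fixes n m :: int
  assumes "6 \<le> n"
  shows
    "(n = 4 * m \<and> 2 \<le> m \<longrightarrow>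
        (\<forall>A. is_minimal_relations_matrix (R2_gens n) A \<longleftrightarrow>
           A = vector [vector [16 * m + 1, - (8 * (2 * m - 1)), - 1],
                       vector [- (15 * m + 1), 16 * m - 7, - (m - 1)],
                       vector [- m, - 1, m]]) \<and>
        int (genus (R2 n)) = 4 * m * (34 * m ^ 2 - 21 * m + 2) \<and>
        frobenius_number (R2 n) = 272 * m ^ 3 - 168 * m ^ 2 + m - 2)
   \<and> (n = 4 * m + 2 \<and> 1 \<le> m \<longrightarrow>
        (\<forall>A. is_minimal_relations_matrix (R2_gens n) A \<longleftrightarrow>
           A = vector [vector [9 * m + 5, - (8 * m - 1), - (m + 1)],
                       vector [- (7 * m + 4), 8 * m + 1, - m],
                       vector [- (2 * m + 1), - 2, 2 * m + 1]]) \<and>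
        int (genus (R2 n)) = m * (80 * m ^ 2 + 71 * m + 16) \<and>
        (m = 1 \<longrightarrow> frobenius_number (R2 n) = 312) \<and>
        (2 \<le> m \<longrightarrow> frobenius_number (R2 n) = 160 * m ^ 3 + 128 * m ^ 2 + 10 * m - 9))
   \<and> (n = 4 * m + 1 \<and> 2 \<le> m \<longrightarrow>
        (\<forall>A. is_minimal_relations_matrix (R2_gens n) A \<longleftrightarrow>
           A = vector [vector [7 * m + 2, - (4 * (m - 1)), - (3 * m + 1)],
                       vector [- (3 * m + 1), 4 * m, - m],
                       vector [- (4 * m + 1), - 4, 4 * m + 1]]) \<and>
        int (genus (R2 n)) = 2 * m * (32 * m ^ 2 + 9 * m + 1) \<and>
        (m \<le> 3 \<longrightarrow> frobenius_number (R2 n) = 112 * m ^ 3 + 48 * m ^ 2 + 8 * m - 1) \<and>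
        (4 \<le> m \<longrightarrow> frobenius_number (R2 n) = 128 * m ^ 3 - 20 * m - 5))
   \<and> (n = 4 * m + 3 \<and> 1 \<le> m \<longrightarrow>
        (\<forall>A. is_minimal_relations_matrix (R2_gens n) A \<longleftrightarrow>
           A = vector [vector [5 * m + 4, - (4 * m), - (m + 1)],
                       vector [- (m + 1), 4 * (m + 1), - (3 * m + 2)],
                       vector [- (4 * m + 3), - 4, 4 * m + 3]]) \<and>
        int (genus (R2 n)) = 2 * (32 * m ^ 3 + 57 * m ^ 2 + 33 * m + 6) \<and>
        frobenius_number (R2 n) = 128 * m ^ 3 + 224 * m ^ 2 + 124 * m + 19)"
proof (intro conjI; intro impI; elim conjE)
  assume n: "n = 4 * m" and m: "2 \<le> m"
  note inv = R2_invariants[of "8 * (2 * m - 1)" "1" "15 * m + 1" "m - 1" "m" "1" n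
      "4 * m * (34 * m ^ 2 - 21 * m + 2)"]
  have matrix: "is_minimal_relations_matrix (R2_gens n) A \<longleftrightarrow> A =
      vector [vector [16 * m + 1, - (8 * (2 * m - 1)), - 1],
        vector [- (15 * m + 1), 16 * m - 7, - (m - 1)],
        vector [- m, - 1, m]]" for A
    by (rule inv(1)[THEN trans]) (use m in \<open>simp_all add: n power2_eq_square power3_eq_cube algebra_simps\<close>)
  have genus: "int (genus (R2 n)) = 4 * m * (34 * m ^ 2 - 21 * m + 2)"
    by (rule inv(2)) (use m in \<open>simp_all add: n power2_eq_square power3_eq_cube algebra_simps\<close>)
  have frob: "frobenius_number (R2 n) = 272 * m ^ 3 - 168 * m ^ 2 + m - 2"
  proof -
    have le: "1 * n\<^sup>2 \<le> (m - 1) * (n + 1)\<^sup>2"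
      by (rule mult_square_mono) (use m n in auto)
    show ?thesis
      by (rule inv(3)[THEN trans]) (use m le in \<open>simp_all add: n power2_eq_square power3_eq_cube algebra_simps\<close>)
  qed
  show "(\<forall>A. is_minimal_relations_matrix (R2_gens n) A \<longleftrightarrow>
           A = vector [vector [16 * m + 1, - (8 * (2 * m - 1)), - 1],
                       vector [- (15 * m + 1), 16 * m - 7, - (m - 1)],
                       vector [- m, - 1, m]]) \<and>
        int (genus (R2 n)) = 4 * m * (34 * m ^ 2 - 21 * m + 2) \<and>
        frobenius_number (R2 n) = 272 * m ^ 3 - 168 * m ^ 2 + m - 2"
    using matrix genus frob by blast
next
  assume n: "n = 4 * m + 2" and m: "1 \<le> m"
  note inv = R2_invariants[of "8 * m - 1" "m + 1" "7 * m + 4" "m" "2 * m + 1" "2" n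
      "m * (80 * m ^ 2 + 71 * m + 16)"]
  have matrix: "is_minimal_relations_matrix (R2_gens n) A \<longleftrightarrow> A =
      vector [vector [9 * m + 5, - (8 * m - 1), - (m + 1)],
        vector [- (7 * m + 4), 8 * m + 1, - m],
        vector [- (2 * m + 1), - 2, 2 * m + 1]]" for A
    by (rule inv(1)[THEN trans]) (use m in \<open>simp_all add: n power2_eq_square power3_eq_cube algebra_simps\<close>)
  have genus: "int (genus (R2 n)) = m * (80 * m ^ 2 + 71 * m + 16)"
    by (rule inv(2)) (use m in \<open>simp_all add: n power2_eq_square power3_eq_cube algebra_simps\<close>)
  have frob: "frobenius_number (R2 n) = 160 * m ^ 3 + 128 * m ^ 2 + 10 * m - 9" if "2 \<le> m"
  proof -
    have le: "2 * n\<^sup>2 \<le> m * (n + 1)\<^sup>2"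
      by (rule mult_square_mono) (use m that n in auto)
    show ?thesis
      by (rule inv(3)[THEN trans]) (use m le in \<open>simp_all add: n power2_eq_square power3_eq_cube algebra_simps\<close>)
  qed
  \<comment> \<open>Here \<open>n = 6\<close>, and \<open>1 * 49 < 2 * 36\<close> makes
    \<open>corner1\<close> the larger corner.\<close>
  have frob': "frobenius_number (R2 n) = 312" if "m = 1"
    by (rule inv(4)[THEN trans]) (use that in \<open>simp_all add: n\<close>)
  show "(\<forall>A. is_minimal_relations_matrix (R2_gens n) A \<longleftrightarrow>
           A = vector [vector [9 * m + 5, - (8 * m - 1), - (m + 1)],
                       vector [- (7 * m + 4), 8 * m + 1, - m],
                       vector [- (2 * m + 1), - 2, 2 * m + 1]]) \<and>
        int (genus (R2 n)) = m * (80 * m ^ 2 + 71 * m + 16) \<and>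
        (m = 1 \<longrightarrow> frobenius_number (R2 n) = 312) \<and>
        (2 \<le> m \<longrightarrow> frobenius_number (R2 n) = 160 * m ^ 3 + 128 * m ^ 2 + 10 * m - 9)"
    using matrix genus frob frob' by blast
next
  assume n: "n = 4 * m + 1" and m: "2 \<le> m"
  note inv = R2_invariants[of "4 * (m - 1)" "3 * m + 1" "3 * m + 1" "m" "4 * m + 1" "4" n
      "2 * m * (32 * m ^ 2 + 9 * m + 1)"]
  have matrix: "is_minimal_relations_matrix (R2_gens n) A \<longleftrightarrow> A =
      vector [vector [7 * m + 2, - (4 * (m - 1)), - (3 * m + 1)],
        vector [- (3 * m + 1), 4 * m, - m],
        vector [- (4 * m + 1), - 4, 4 * m + 1]]" for A
    by (rule inv(1)[THEN trans]) (use m in \<open>simp_all add: n power2_eq_square power3_eq_cube algebra_simps\<close>)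
  have genus: "int (genus (R2 n)) = 2 * m * (32 * m ^ 2 + 9 * m + 1)"
    by (rule inv(2)) (use m in \<open>simp_all add: n power2_eq_square power3_eq_cube algebra_simps\<close>)
  have frob: "frobenius_number (R2 n) = 128 * m ^ 3 - 20 * m - 5" if "4 \<le> m"
  proof -
    have le: "4 * n\<^sup>2 \<le> m * (n + 1)\<^sup>2"
      by (rule mult_square_mono) (use m that n in auto)
    show ?thesis
      by (rule inv(3)[THEN trans]) (use m le in \<open>simp_all add: n power2_eq_square power3_eq_cube algebra_simps\<close>)
  qed
  have frob': "frobenius_number (R2 n) = 112 * m ^ 3 + 48 * m ^ 2 + 8 * m - 1" if m3: "m \<le> 3"
  proof -
    \<comment> \<open>For \<open>n = 9\<close> and \<open>n = 13\<close> the comparisons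
      \<open>2 * 100 < 4 * 81\<close> and \<open>3 * 196 < 4 * 169\<close> favour
      \<open>corner1\<close>; from \<open>m = 4\<close> on \<open>corner2\<close> takes
      over.\<close>
    consider "m = 2" | "m = 3" using m m3 by linarith
    then show ?thesis
      by cases (rule inv(4)[THEN trans]; simp add: n)+
  qed
  show "(\<forall>A. is_minimal_relations_matrix (R2_gens n) A \<longleftrightarrow>
           A = vector [vector [7 * m + 2, - (4 * (m - 1)), - (3 * m + 1)],
                       vector [- (3 * m + 1), 4 * m, - m],
                       vector [- (4 * m + 1), - 4, 4 * m + 1]]) \<and>
        int (genus (R2 n)) = 2 * m * (32 * m ^ 2 + 9 * m + 1) \<and>
        (m \<le> 3 \<longrightarrow> frobenius_number (R2 n) = 112 * m ^ 3 + 48 * m ^ 2 + 8 * m - 1) \<and>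
        (4 \<le> m \<longrightarrow> frobenius_number (R2 n) = 128 * m ^ 3 - 20 * m - 5)"
    using matrix genus frob frob' by blast
next
  assume n: "n = 4 * m + 3" and m: "1 \<le> m"
  note inv = R2_invariants[of "4 * m" "m + 1" "m + 1" "3 * m + 2" "4 * m + 3" "4" n
      "2 * (32 * m ^ 3 + 57 * m ^ 2 + 33 * m + 6)"]
  have matrix: "is_minimal_relations_matrix (R2_gens n) A \<longleftrightarrow> A =
      vector [vector [5 * m + 4, - (4 * m), - (m + 1)],
        vector [- (m + 1), 4 * (m + 1), - (3 * m + 2)],
        vector [- (4 * m + 3), - 4, 4 * m + 3]]" for A
    by (rule inv(1)[THEN trans]) (use m in \<open>simp_all add: n power2_eq_square power3_eq_cube algebra_simps\<close>)
  have genus: "int (genus (R2 n)) = 2 * (32 * m ^ 3 + 57 * m ^ 2 + 33 * m + 6)"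
    by (rule inv(2)) (use m in \<open>simp_all add: n power2_eq_square power3_eq_cube algebra_simps\<close>)
  have frob: "frobenius_number (R2 n) = 128 * m ^ 3 + 224 * m ^ 2 + 124 * m + 19"
  proof -
    have le: "4 * n\<^sup>2 \<le> (3 * m + 2) * (n + 1)\<^sup>2"
      by (rule mult_square_mono) (use m n in auto)
    show ?thesis
      by (rule inv(3)[THEN trans]) (use m le in \<open>simp_all add: n power2_eq_square power3_eq_cube algebra_simps\<close>)
  qed
  show "(\<forall>A. is_minimal_relations_matrix (R2_gens n) A \<longleftrightarrow>
           A = vector [vector [5 * m + 4, - (4 * m), - (m + 1)],
                       vector [- (m + 1), 4 * (m + 1), - (3 * m + 2)],
                       vector [- (4 * m + 3), - 4, 4 * m + 3]]) \<and>
        int (genus (R2 n)) = 2 * (32 * m ^ 3 + 57 * m ^ 2 + 33 * m + 6) \<and>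
        frobenius_number (R2 n) = 128 * m ^ 3 + 224 * m ^ 2 + 124 * m + 19"
    using matrix genus frob by blast
qed

end
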